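(* Let $p\ge 1$. Any algorithm (possibly adaptive and randomized) that, using only a connected-component-counting ($\#$CC) oracle, solves the Graph Reconstruction problem with probability greater than $1/2$ on all instances whose hidden graph has maximum degree at most $p$ must perform $\Omega(np/\log n)$ $\#$CC queries on some such instance, where $n$ is the number of vertices. The same holds with "maximum degree at most $p$" replaced by "treewidth at most $p$" or by "degeneracy at most $p$".
   Context: Graph Reconstruction (GR): an unknown ("hidden") simple undirected graph $G=(V,E)$ on a known vertex set $V$ with $|V|=n$ is to be determined, i.e. the algorithm must output $E$. A $\#$CC oracle, on query $S\subseteq V$, returns only the number of connected components of the induced subgraph $G[S]$. Complexity is the number of queries. The degeneracy of a graph is the smallest integer $d$ such that every induced subgraph has a vertex of degree at most $d$. *)

theory Defs
  imports "HOL-Probability.Probability"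
begin

section \<open>Finite simple undirected graphs\<close>

text \<open>A graph is given by a vertex set and a set of two-element edges.\<close>

definition simple_graph :: "'a set \<Rightarrow> 'a set set \<Rightarrow> bool" where
  "simple_graph V E \<longleftrightarrow> finite V \<and> (\<forall>e\<in>E. e \<subseteq> V \<and> card e = 2)"

definition induced_edges :: "'a set set \<Rightarrow> 'a set \<Rightarrow> 'a set set" where
  "induced_edges E S = {e \<in> E. e \<subseteq> S}"

definition connected_components :: "'a set \<Rightarrow> 'a set set \<Rightarrow> 'a set set" where
  "connected_components V E =
     V // {(u, v). u \<in> V \<and> v \<in> V \<and> (u, v) \<in> {(x, y). {x, y} \<in> E}\<^sup>*}"

definition cc_count :: "'a set set \<Rightarrow> 'a set \<Rightarrow> nat" where
  "cc_count E S = card (connected_components S (induced_edges E S))"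

definition connected_graph :: "'a set \<Rightarrow> 'a set set \<Rightarrow> bool" where
  "connected_graph V E \<longleftrightarrow> card (connected_components V E) = 1"


section \<open>Maximum degree, degeneracy, treewidth\<close>

definition vertex_degree :: "'a set set \<Rightarrow> 'a \<Rightarrow> nat" where
  "vertex_degree E v = card {e \<in> E. v \<in> e}"

definition max_degree :: "'a set \<Rightarrow> 'a set set \<Rightarrow> nat" where
  "max_degree V E = Max (insert 0 (vertex_degree E ` V))"

definition degeneracy :: "'a set \<Rightarrow> 'a set set \<Rightarrow> nat" where
  "degeneracy V E =
     (LEAST d. \<forall>S\<subseteq>V. S \<noteq> {} \<longrightarrow> (\<exists>v\<in>S. vertex_degree (induced_edges E S) v \<le> d))"

definition is_cycle :: "'a set set \<Rightarrow> 'a list \<Rightarrow> bool" where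
  "is_cycle E vs \<longleftrightarrow> 3 \<le> length vs \<and> distinct vs \<and>
     (\<forall>i<length vs. {vs ! i, vs ! (Suc i mod length vs)} \<in> E)"

definition is_tree :: "'a set \<Rightarrow> 'a set set \<Rightarrow> bool" where
  "is_tree V E \<longleftrightarrow> simple_graph V E \<and> connected_graph V E \<and> (\<nexists>vs. is_cycle E vs)"

definition tree_decomposition ::
  "'a set \<Rightarrow> 'a set set \<Rightarrow> 'i set \<Rightarrow> 'i set set \<Rightarrow> ('i \<Rightarrow> 'a set) \<Rightarrow> bool" where
  "tree_decomposition V E I F bag \<longleftrightarrow>
     is_tree I F \<and> (\<Union>i\<in>I. bag i) = V \<and> (\<forall>e\<in>E. \<exists>i\<in>I. e \<subseteq> bag i) \<and>
     (\<forall>v\<in>V. connected_graph {i \<in> I. v \<in> bag i} (induced_edges F {i \<in> I. v \<in> bag i}))"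

definition decomposition_width :: "'i set \<Rightarrow> ('i \<Rightarrow> 'a set) \<Rightarrow> nat" where
  "decomposition_width I bag = Max ((\<lambda>i. card (bag i)) ` I) - 1"

text \<open>Since decomposition trees are finite, natural numbers suffice as their nodes.  (For the
  empty graph the truncated subtraction gives width 0 rather than -1.)\<close>

definition treewidth :: "'a set \<Rightarrow> 'a set set \<Rightarrow> nat" where
  "treewidth V E =
     (LEAST w. \<exists>(I :: nat set) F bag.
        tree_decomposition V E I F bag \<and> w = decomposition_width I bag)"

definition graphs_with_param_le ::
  "('a set \<Rightarrow> 'a set set \<Rightarrow> nat) \<Rightarrow> 'a set \<Rightarrow> nat \<Rightarrow> 'a set set set" where
  "graphs_with_param_le param V p = {E. simple_graph V E \<and> param V E \<le> p}"


section \<open>Query algorithms\<close>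

text \<open>A deterministic adaptive algorithm is a decision tree: it either outputs an edge set, or
  queries a vertex set and continues depending on the number it receives.  A randomized algorithm
  is a probability distribution over such trees.\<close>

datatype 'a query_alg =
    Output "'a set set"
  | Query "'a set" "nat \<Rightarrow> 'a query_alg"

primrec queries_within :: "'a set \<Rightarrow> 'a query_alg \<Rightarrow> bool" where
  "queries_within V (Output R) \<longleftrightarrow> True"
| "queries_within V (Query S k) \<longleftrightarrow> S \<subseteq> V \<and> (\<forall>a. queries_within V (k a))"

primrec run_output :: "('a set \<Rightarrow> nat) \<Rightarrow> 'a query_alg \<Rightarrow> 'a set set" where
  "run_output orc (Output R) = R"
| "run_output orc (Query S k) = run_output orc (k (orc S))"

primrec num_queries :: "('a set \<Rightarrow> nat) \<Rightarrow> 'a query_alg \<Rightarrow> nat" where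
  "num_queries orc (Output R) = 0"
| "num_queries orc (Query S k) = Suc (num_queries orc (k (orc S)))"

definition solves_reconstruction ::
  "'a set \<Rightarrow> 'a set set set \<Rightarrow> 'a query_alg pmf \<Rightarrow> bool" where
  "solves_reconstruction V C A \<longleftrightarrow>
     (\<forall>t\<in>set_pmf A. queries_within V t) \<and>
     (\<forall>E\<in>C. measure_pmf.prob A {t. run_output (cc_count E) t = E} > 1 / 2)"

text \<open>An extended nonnegative integral, so that an infinite expectation counts as infinite.\<close>

definition expected_queries :: "'a query_alg pmf \<Rightarrow> 'a set set \<Rightarrow> ennreal" where
  "expected_queries A E = (\<integral>\<^sup>+t. of_nat (num_queries (cc_count E) t) \<partial>measure_pmf A)"

text \<open>A lower bound on the expected number of queries is also one on the worst case over the
  random choices.\<close>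

lemma expected_queries_imp_worst_case:
  assumes "ennreal b \<le> expected_queries A E"
  shows "\<exists>t\<in>set_pmf A. b \<le> real (num_queries (cc_count E) t)"
proof (rule ccontr)
  assume "\<not> ?thesis"
  then have less: "real (num_queries (cc_count E) t) < b" if "t \<in> set_pmf A" for t
    using that by (auto simp: not_le)
  obtain t0 where "t0 \<in> set_pmf A"
    using set_pmf_not_empty[of A] by auto
  from less[OF this] have "0 < b" by linarith
  define m where "m = nat (\<lceil>b\<rceil> - 1)"
  have m: "real m < b" using \<open>0 < b\<close> unfolding m_def by linarith
  have le: "num_queries (cc_count E) t \<le> m" if "t \<in> set_pmf A" for t
    using less[OF that] unfolding m_def by linarith
  have "expected_queries A E \<le> (\<integral>\<^sup>+t. ennreal (real m) \<partial>measure_pmf A)"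
    unfolding expected_queries_def
    by (intro nn_integral_mono_AE) (auto simp: AE_measure_pmf_iff ennreal_of_nat_eq_real_of_nat le)
  also have "\<dots> = ennreal (real m)" by simp
  also have "\<dots> < ennreal b" using m \<open>0 < b\<close> by (simp add: ennreal_lessI)
  finally show False using assms by simp
qed

end

theory Submission imports Defs begin

text \<open>Cut the vertices into blocks of size \<open>p + 1\<close> and let the hidden graph have edges only inside
  blocks: every such graph has all three parameters at most \<open>p\<close>, and there are at least
  \<open>2 powr (n p / 4)\<close> of them. A query has at most \<open>n + 1\<close> answers, so a deterministic algorithm is
  right within \<open>k\<close> queries on at most \<open>(n + 1) ^ k\<close> graphs. Averaged over the family, a randomized
  algorithm that is right with probability more than \<open>1/2\<close> must therefore exceed
  \<open>k \<approx> n p / log n\<close> queries with probability at least \<open>1/4\<close> on some graph.\<close>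

section \<open>Information-theoretic lower bound\<close>

lemma cc_count_le_card:
  assumes "finite S"
  shows "cc_count E S \<le> card S"
  unfolding cc_count_def connected_components_def
  by (subst proj_image[symmetric]) (rule card_image_le[OF assms])

text \<open>Only the branching matters: each node has at most \<open>n + 1\<close> possible answers,
  so at most \<open>(n + 1) ^ k\<close> leaves lie at depth at most \<open>k\<close>. Nothing about
  graphs enters, hence the arbitrary bounded oracle. Finiteness is carried through the induction
  because \<open>card\<close> is 0 on infinite sets.\<close>

lemma outputs_within_queries:
  assumes "queries_within V t"
  shows "finite {run_output orc t | orc. (\<forall>S\<subseteq>V. orc S \<le> n) \<and> num_queries orc t \<le> k} \<and>
    card {run_output orc t | orc. (\<forall>S\<subseteq>V. orc S \<le> n) \<and> num_queries orc t \<le> k} \<le> Suc n ^ k"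
  using assms
proof (induction t arbitrary: k)
  case (Output R)
  have "{run_output orc (Output R) | orc. (\<forall>S\<subseteq>V. orc S \<le> n) \<and> num_queries orc (Output R) \<le> k}
    \<subseteq> {R}" (is "?X \<subseteq> _")
    by auto
  then have "finite ?X" "card ?X \<le> 1"
    using finite_subset card_mono[of "{R}" ?X] by auto
  moreover have "1 \<le> Suc n ^ k"
    by (rule one_le_power) simp
  ultimately show ?case by linarith
next
  case (Query S f)
  define X where "X t k = {run_output orc t | orc. (\<forall>S\<subseteq>V. orc S \<le> n) \<and> num_queries orc t \<le> k}"
    for t k
  have "finite (X (Query S f) k) \<and> card (X (Query S f) k) \<le> Suc n ^ k"
  proof (cases k)
    \<comment> \<open>A \<open>Query\<close> node cannot stop after zero queries, so the set is
      empty.\<close>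
    case 0
    then show ?thesis by (simp add: X_def)
  next
    case (Suc j)
    have fin: "finite (X (f a) j)" and le: "card (X (f a) j) \<le> Suc n ^ j" for a
      using Query.IH[of "f a" j] Query.prems by (auto simp: X_def)
    \<comment> \<open>The first answer \<open>a\<close> selects the subtree \<open>f a\<close>,
      which has one query less to spend.\<close>
    have sub: "X (Query S f) k \<subseteq> (\<Union>a\<in>{..n}. X (f a) j)"
    proof
      fix R assume "R \<in> X (Query S f) k"
      then obtain orc where orc: "\<forall>S\<subseteq>V. orc S \<le> n" "num_queries orc (Query S f) \<le> k"
        and R: "R = run_output orc (Query S f)"
        by (auto simp only: X_def)
      then have "R \<in> X (f (orc S)) j"
        using Suc by (auto simp: X_def)
      moreover have "orc S \<le> n"
        using orc Query.prems by simp
      ultimately show "R \<in> (\<Union>a\<in>{..n}. X (f a) j)" by blast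
    qed
    have "card (X (Query S f) k) \<le> card (\<Union>a\<in>{..n}. X (f a) j)"
      using sub fin by (intro card_mono) auto
    also have "\<dots> \<le> (\<Sum>a\<in>{..n}. card (X (f a) j))"
      by (intro card_UN_le) auto
    also have "\<dots> \<le> (\<Sum>a\<in>{..n}. Suc n ^ j)"
      by (intro sum_mono le)
    also have "\<dots> = Suc n ^ k"
      by (simp add: Suc)
    finally have "card (X (Query S f) k) \<le> Suc n ^ k" .
    moreover have "finite (X (Query S f) k)"
      using fin by (intro finite_subset[OF sub]) simp
    ultimately show ?thesis by blast
  qed
  then show ?case by (simp add: X_def)
qed

text \<open>A correctly reconstructed graph is itself an output of \<open>t\<close>, so these graphs
  form a subset of the reachable outputs.\<close>

lemma card_reconstructed_within:
  assumes "finite V" "queries_within V t"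
  shows "card {E \<in> F. run_output (cc_count E) t = E \<and> num_queries (cc_count E) t \<le> k}
    \<le> Suc (card V) ^ k"
proof -
  let ?X = "{run_output orc t | orc. (\<forall>S\<subseteq>V. orc S \<le> card V) \<and> num_queries orc t \<le> k}"
  have cc_le: "\<forall>S\<subseteq>V. cc_count E S \<le> card V" for E
    using assms(1) by (meson card_mono cc_count_le_card finite_subset order_trans)
  have "{E \<in> F. run_output (cc_count E) t = E \<and> num_queries (cc_count E) t \<le> k} \<subseteq> ?X"
  proof
    fix E assume "E \<in> {E \<in> F. run_output (cc_count E) t = E \<and> num_queries (cc_count E) t \<le> k}"
    then have "E = run_output (cc_count E) t \<and> (\<forall>S\<subseteq>V. cc_count E S \<le> card V) \<and>
        num_queries (cc_count E) t \<le> k"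
      using cc_le[of E] by simp
    then show "E \<in> ?X" by blast
  qed
  then show ?thesis
    using outputs_within_queries[OF assms(2), of "card V" k] by (meson card_mono order_trans)
qed

text \<open>\<open>F\<close> plays the role of a uniform prior: no fixed tree is both correct and
  short on more than a quarter of \<open>F\<close>, so neither is the random tree on
  average.\<close>

lemma solves_reconstruction_expected_queries:
  fixes A :: "'a query_alg pmf"
  assumes "finite V" "finite F" "F \<noteq> {}" "F \<subseteq> C"
    and solves: "solves_reconstruction V C A"
    and k: "4 * Suc (card V) ^ k \<le> card F"
  shows "\<exists>E\<in>F. ennreal (real (Suc k) / 4) \<le> expected_queries A E"
proof -
  let ?P = "measure_pmf.prob A"
  define ok where "ok E = {t. run_output (cc_count E) t = E}" for E :: "'a set set"
  define long where "long E = {t. k < num_queries (cc_count E) t}" for E :: "'a set set"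
  have "(\<Sum>E\<in>F. ?P (ok E - long E)) = (\<Sum>E\<in>F. \<integral>t. indicator (ok E - long E) t \<partial>measure_pmf A)"
    by simp
  also have "\<dots> = (\<integral>t. (\<Sum>E\<in>F. indicator (ok E - long E) t) \<partial>measure_pmf A)"
    by (subst Bochner_Integration.integral_sum) (auto simp: measure_pmf.emeasure_eq_measure)
  also have "\<dots> \<le> (\<integral>t. real (Suc (card V) ^ k) \<partial>measure_pmf A)"
  proof (intro integral_mono_AE)
    show "AE t in measure_pmf A. (\<Sum>E\<in>F. indicator (ok E - long E) t) \<le> real (Suc (card V) ^ k)"
    proof (rule AE_pmfI)
      fix t assume "t \<in> set_pmf A"
      then have "queries_within V t"
        using solves by (simp add: solves_reconstruction_def)
      \<comment> \<open>For a fixed tree the sum counts the graphs it gets right within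
        \<open>k\<close> queries.\<close>
      have "(\<Sum>E\<in>F. indicator (ok E - long E) t) = real (card {E \<in> F. t \<in> ok E - long E})"
        using \<open>finite F\<close> by (simp add: indicator_def sum.If_cases Int_def)
      also have "\<dots> \<le> real (Suc (card V) ^ k)"
        using card_reconstructed_within[OF \<open>finite V\<close> \<open>queries_within V t\<close>, of F k]
        by (simp add: ok_def long_def not_less del: of_nat_power)
      finally show "(\<Sum>E\<in>F. indicator (ok E - long E) t) \<le> real (Suc (card V) ^ k)" .
    qed
  qed (auto simp: measure_pmf.emeasure_eq_measure)
  also have "\<dots> \<le> real (card F) / 4"
    using k by (simp del: of_nat_power)
  finally have short: "(\<Sum>E\<in>F. ?P (ok E - long E)) \<le> real (card F) / 4" .
  have "\<exists>E\<in>F. 1/4 \<le> ?P (long E)"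
  proof (rule ccontr)
    assume "\<not> ?thesis"
    then have small: "?P (long E) < 1/4" if "E \<in> F" for E
      using that by force
    \<comment> \<open>Success exceeds 1/2 and long runs would have probability below 1/4, so more
      than 1/4 is left for short correct runs; summed over \<open>F\<close>, this contradicts
      \<open>short\<close>.\<close>
    have "1/4 < ?P (ok E - long E)" if "E \<in> F" for E
    proof -
      have "1/2 < ?P (ok E)"
        using solves that \<open>F \<subseteq> C\<close> by (auto simp: solves_reconstruction_def ok_def)
      also have "?P (ok E) \<le> ?P ((ok E - long E) \<union> long E)"
        by (intro measure_pmf.finite_measure_mono) auto
      also have "\<dots> \<le> ?P (ok E - long E) + ?P (long E)"
        by (intro measure_subadditive) auto
      finally show ?thesis
        using small[OF that] by linarith
    qed
    then have "(\<Sum>E\<in>F. 1/4) < (\<Sum>E\<in>F. ?P (ok E - long E))"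
      by (intro sum_strict_mono \<open>finite F\<close> \<open>F \<noteq> {}\<close>)
    with short show False by simp
  qed
  then obtain E where E: "E \<in> F" "1/4 \<le> ?P (long E)" by blast
  \<comment> \<open>Markov's inequality: a run in \<open>long E\<close> makes at least
    \<open>Suc k\<close> queries.\<close>
  have "ennreal (real (Suc k) / 4) \<le> ennreal (real (Suc k) * ?P (long E))"
    using mult_left_mono[OF E(2), of "real (Suc k)"] by (intro ennreal_leI) simp
  also have "\<dots> = ennreal (real (Suc k)) * emeasure (measure_pmf A) (long E)"
    by (simp add: ennreal_mult measure_pmf.emeasure_eq_measure del: of_nat_Suc)
  also have "\<dots> = (\<integral>\<^sup>+t. ennreal (real (Suc k)) * indicator (long E) t \<partial>measure_pmf A)"
    by (simp add: nn_integral_cmult_indicator del: of_nat_Suc)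
  also have "\<dots> \<le> expected_queries A E"
    unfolding expected_queries_def
    by (intro nn_integral_mono)
      (auto simp: indicator_def long_def ennreal_of_nat_eq_real_of_nat simp del: of_nat_Suc)
  finally show ?thesis
    using E(1) by blast
qed

section \<open>Graphs with edges inside blocks\<close>

definition block :: "nat \<Rightarrow> nat \<Rightarrow> nat \<Rightarrow> nat set" where
  "block n k i = {v. v < n \<and> v div k = i}"

text \<open>Every vertex \<open>v < n\<close> has block index \<open>v div k < n\<close>, so the
  range \<open>i<n\<close> catches all blocks; surplus indices give empty blocks.\<close>

definition block_edges :: "nat \<Rightarrow> nat \<Rightarrow> nat set set" where
  "block_edges n k = (\<Union>i<n. {e. e \<subseteq> block n k i \<and> card e = 2})"

lemma finite_block [simp]: "finite (block n k i)"
  by (simp add: block_def)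

lemma block_subset:
  assumes "0 < k"
  shows "block n k i \<subseteq> {i * k..<i * k + k}"
  using assms unfolding block_def
  by (auto simp: div_times_less_eq_dividend dividend_less_times_div mult.commute add.commute)

lemma card_block_le:
  assumes "0 < k"
  shows "card (block n k i) \<le> k"
  using card_mono[OF _ block_subset[OF assms]] by fastforce

lemma full_block:
  assumes "0 < k" "i < n div k"
  shows "block n k i = {i * k..<i * k + k}"
proof -
  have "Suc i * k \<le> n div k * k"
    using assms by (intro mult_le_mono1) simp
  also have "\<dots> \<le> n" by simp
  finally have "i * k + k \<le> n" by simp
  moreover have "v div k = i" if "i * k \<le> v" "v < i * k + k" for v
    using that by (intro div_nat_eqI) (auto simp: mult.commute)
  ultimately have "{i * k..<i * k + k} \<subseteq> block n k i"
    unfolding block_def by auto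
  with block_subset[OF assms(1)] show ?thesis by blast
qed

lemma finite_block_edges [simp]: "finite (block_edges n k)"
  unfolding block_edges_def by (auto intro: finite_subset[of _ "Pow (block n k _)"])

lemma simple_graph_block_edges:
  assumes "E \<subseteq> block_edges n k"
  shows "simple_graph {..<n} E"
  using assms unfolding simple_graph_def block_edges_def block_def by fastforce

text \<open>With \<open>k = p + 1\<close>, there are \<open>m = n div k\<close> full blocks with
  \<open>k * p / 2\<close> pairs each. As \<open>k \<le> n\<close>, the full blocks cover at least
  half of the vertices, which gives the factor 1/4.\<close>

lemma card_block_edges:
  assumes "p < n"
  shows "real n * real p / 4 \<le> real (card (block_edges n (Suc p)))"
proof -
  define k where "k = Suc p"
  define m where "m = n div k"
  have k: "0 < k" "k \<le> n" using assms by (auto simp: k_def)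
  let ?K = "\<lambda>i. {e. e \<subseteq> block n k i \<and> card e = 2}"
  have "card (\<Union>i<m. ?K i) = (\<Sum>i<m. card (?K i))"
  proof (rule card_UN_disjoint)
    show "\<forall>i\<in>{..<m}. finite (?K i)"
      by (auto intro: finite_subset[of _ "Pow (block n k _)"])
    have "?K i \<inter> ?K j = {}" if "i \<noteq> j" for i j
    proof -
      have "e = {}" if "e \<subseteq> block n k i" "e \<subseteq> block n k j" for e
        using that \<open>i \<noteq> j\<close> by (auto simp: block_def)
      then have "e \<notin> ?K i \<inter> ?K j" for e
        by (cases "e = {}") auto
      then show ?thesis by blast
    qed
    then show "\<forall>i\<in>{..<m}. \<forall>j\<in>{..<m}. i \<noteq> j \<longrightarrow> ?K i \<inter> ?K j = {}"
      by blast
  qed simp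
  also have "\<dots> = (\<Sum>i<m. k choose 2)"
    using k by (intro sum.cong) (auto simp: n_subsets full_block m_def)
  finally have "card (\<Union>i<m. ?K i) = m * (k choose 2)" by simp
  moreover have "card (\<Union>i<m. ?K i) \<le> card (block_edges n k)"
  proof (rule card_mono)
    have "m \<le> n" by (simp add: m_def)
    then show "(\<Union>i<m. ?K i) \<subseteq> block_edges n k"
      unfolding block_edges_def by (intro UN_mono) auto
  qed simp
  moreover have "n * p \<le> 4 * (m * (k choose 2))"
  proof -
    have "1 \<le> m"
      using k by (simp add: m_def Suc_le_eq div_greater_zero_iff)
    then have "k \<le> m * k" by simp
    moreover have "n < m * k + k"
      using k by (simp add: m_def dividend_less_div_times add.commute)
    ultimately have "n \<le> 2 * (m * k)" by linarith
    then have "n * p \<le> 2 * (m * k) * p" by (rule mult_le_mono1)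
    moreover have "2 * (k choose 2) = k * p"
      by (simp add: choose_two k_def)
    then have "2 * (m * k) * p = 2 * m * (2 * (k choose 2))"
      by (simp only: mult.assoc)
    ultimately show ?thesis by simp
  qed
  ultimately have "n * p \<le> 4 * card (block_edges n k)" by linarith
  then have "real (n * p) \<le> real (4 * card (block_edges n k))" by (rule of_nat_mono)
  then show ?thesis by (simp add: k_def)
qed

section \<open>Degree, degeneracy and treewidth of block graphs\<close>

lemma vertex_degree_block_edges:
  assumes "E \<subseteq> block_edges n (Suc p)"
  shows "vertex_degree E v \<le> p"
proof -
  let ?B = "block n (Suc p) (v div Suc p)"
  have "{e \<in> E. v \<in> e} \<subseteq> (\<lambda>u. {v, u}) ` (?B - {v})"
  proof
    fix e assume "e \<in> {e \<in> E. v \<in> e}"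
    then obtain i where i: "e \<subseteq> block n (Suc p) i" "card e = 2" "v \<in> e"
      using assms by (auto simp: block_edges_def)
    then obtain u where "e = {v, u}" "u \<noteq> v"
      by (auto simp: card_2_iff)
    with i show "e \<in> (\<lambda>u. {v, u}) ` (?B - {v})"
      by (auto simp: block_def)
  qed
  then have le: "vertex_degree E v \<le> card (?B - {v})"
    unfolding vertex_degree_def by (rule surj_card_le[rotated]) simp
  show ?thesis
  proof (cases "v < n")
    case True
    then have "v \<in> ?B" by (simp add: block_def)
    then show ?thesis using le card_block_le[of "Suc p" n "v div Suc p"] by simp
  next
    \<comment> \<open>Here \<open>v\<close> is not in \<open>?B\<close>, so deleting it saves
      nothing; but no edge contains \<open>v\<close>.\<close>
    case False
    then have "{e \<in> E. v \<in> e} = {}"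
      using assms by (auto simp: block_edges_def block_def)
    then show ?thesis unfolding vertex_degree_def by (metis card.empty le0)
  qed
qed

lemma max_degree_block_edges:
  assumes "E \<subseteq> block_edges n (Suc p)"
  shows "max_degree {..<n} E \<le> p"
  using vertex_degree_block_edges[OF assms] by (simp add: max_degree_def)

text \<open>Subsets of \<open>block_edges\<close> inherit the degree bound, so any vertex of
  \<open>S\<close> is a witness.\<close>

lemma degeneracy_block_edges:
  assumes "E \<subseteq> block_edges n (Suc p)"
  shows "degeneracy {..<n} E \<le> p"
  unfolding degeneracy_def
proof (intro Least_le allI impI)
  fix S :: "nat set" assume "S \<noteq> {}"
  have "induced_edges E S \<subseteq> block_edges n (Suc p)"
    using assms by (auto simp: induced_edges_def)
  with \<open>S \<noteq> {}\<close> show "\<exists>v\<in>S. vertex_degree (induced_edges E S) v \<le> p"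
    using vertex_degree_block_edges by blast
qed

text \<open>The star with centre 0 serves as the decomposition tree whose nodes are the block
  indices.\<close>

lemma is_tree_star:
  assumes "0 < n"
  shows "is_tree {..<n} {{0, i} | i :: nat. 0 < i \<and> i < n}" (is "is_tree ?V ?F")
proof -
  let ?r = "{(x, y). {x, y} \<in> ?F}\<^sup>*"
  have centre: "(0, i) \<in> ?r \<and> (i, 0) \<in> ?r" if "i < n" for i
  proof (cases "i = 0")
    case False
    then have "{0, i} \<in> ?F" "{i, 0} \<in> ?F"
      using that by (auto simp: insert_commute)
    then show ?thesis by (blast intro: r_into_rtrancl)
  qed simp
  have "(u, v) \<in> ?r" if "u < n" "v < n" for u v
    by (rule rtrancl_trans[of u 0]) (use centre that in auto)
  then have "{(u, v). u \<in> ?V \<and> v \<in> ?V \<and> (u, v) \<in> ?r} = ?V \<times> ?V"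
    by auto
  moreover have "?V // (?V \<times> ?V) = {?V}"
    using assms by (auto simp: quotient_def)
  ultimately have "connected_graph ?V ?F"
    by (simp add: connected_graph_def connected_components_def)
  moreover have "\<not> is_cycle ?F vs" for vs
  proof
    assume cyc: "is_cycle ?F vs"
    then have len: "3 \<le> length vs" "vs \<noteq> []" and dist: "distinct vs"
      by (auto simp: is_cycle_def)
    have zero: "vs ! i = 0 \<or> vs ! (Suc i mod length vs) = 0" if "i < length vs" for i
      using cyc that by (auto simp: is_cycle_def doubleton_eq_iff)
    have inj: "i = j" if "vs ! i = 0" "vs ! j = 0" "i < length vs" "j < length vs" for i j
      using that dist nth_eq_iff_index_eq by metis
    \<comment> \<open>Every edge contains 0, but a cycle visits 0 only once. Its first two edges
      force 0 to position 1, and the edge leaving position 2 then misses it: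
      \<open>3 mod length vs\<close> is 0 or 3.\<close>
    have "vs ! 0 = 0 \<or> vs ! 1 = 0"
      using zero[of 0] len by fastforce
    moreover have "vs ! 1 = 0 \<or> vs ! 2 = 0"
      using zero[of 1] len by (simp add: numeral_2_eq_2)
    ultimately have one: "vs ! 1 = 0"
      using inj[of 0 2] len by auto
    have "vs ! (3 mod length vs) = 0"
      using zero[of 2] inj[of 1 2] one len by (auto simp: numeral_3_eq_3 numeral_2_eq_2)
    then have "3 mod length vs = 1"
      using inj[of 1 "3 mod length vs"] one len by simp
    then show False
      using len by (cases "length vs = 3") auto
  qed
  moreover have "simple_graph ?V ?F"
    using assms by (auto simp: simple_graph_def)
  ultimately show ?thesis
    by (simp add: is_tree_def)
qed

text \<open>The blocks are pairwise disjoint, so they can be hung on any tree.\<close>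

lemma treewidth_block_edges:
  assumes "0 < n" "E \<subseteq> block_edges n (Suc p)"
  shows "treewidth {..<n} E \<le> p"
proof -
  let ?F = "{{0, i} | i :: nat. 0 < i \<and> i < n}"
  let ?bag = "block n (Suc p)"
  have "connected_graph {i \<in> {..<n}. v \<in> ?bag i} (induced_edges ?F {i \<in> {..<n}. v \<in> ?bag i})"
    if "v < n" for v
  proof -
    have "v div Suc p < n"
      using that by (meson div_le_dividend le_less_trans)
    \<comment> \<open>Each vertex lies in exactly one bag, so its subtree is a single node.\<close>
    then have "{i \<in> {..<n}. v \<in> ?bag i} = {v div Suc p}"
      using that by (auto simp: block_def)
    then show ?thesis
      by (simp add: connected_graph_def connected_components_def singleton_quotient)
  qed
  moreover have "(\<Union>i\<in>{..<n}. ?bag i) = {..<n}"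
    by (auto simp: block_def intro: le_less_trans[OF div_le_dividend])
  moreover have "\<forall>e\<in>E. \<exists>i\<in>{..<n}. e \<subseteq> ?bag i"
    using assms(2) by (fastforce simp: block_edges_def)
  ultimately have "tree_decomposition {..<n} E {..<n} ?F ?bag"
    using is_tree_star[OF assms(1)] by (simp add: tree_decomposition_def)
  then have "treewidth {..<n} E \<le> decomposition_width {..<n} ?bag"
    unfolding treewidth_def by (intro Least_le) blast
  also have "\<dots> \<le> p"
  proof -
    have "Max ((\<lambda>i. card (?bag i)) ` {..<n}) \<le> Suc p"
      using assms(1) card_block_le[of "Suc p"] by (subst Max_le_iff) auto
    then show ?thesis by (simp add: decomposition_width_def)
  qed
  finally show ?thesis .
qed

section \<open>Choice of constants and the final bound\<close>

theorem theorem13: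
  fixes param :: "nat set \<Rightarrow> nat set set \<Rightarrow> nat"
  assumes "param \<in> {max_degree, treewidth, degeneracy}"
  shows "\<exists>c>0. \<exists>N. \<forall>n\<ge>N. \<forall>p. 1 \<le> p \<and> p < n \<longrightarrow>
    (\<forall>A :: nat query_alg pmf.
       solves_reconstruction {..<n} (graphs_with_param_le param {..<n} p) A \<longrightarrow>
       (\<exists>E \<in> graphs_with_param_le param {..<n} p.
          ennreal (c * real n * real p / ln (real n)) \<le> expected_queries A E))"
\<comment> \<open>The 64 is 8 * 2 * 4: \<open>b - 2\<close> is at least \<open>n * p / 8\<close>,
  \<open>ln (n + 1)\<close> is at most \<open>2 * ln n\<close>, and the expectation bound loses 4.
  The threshold 16 ensures \<open>b \<ge> 4\<close>.\<close>
proof (intro exI[of _ "ln 2 / 64"] exI[of _ 16] conjI allI impI)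
  fix n p :: nat and A :: "nat query_alg pmf"
  assume n: "16 \<le> n" and p: "1 \<le> p \<and> p < n"
    and solves: "solves_reconstruction {..<n} (graphs_with_param_le param {..<n} p) A"
  define F where "F = Pow (block_edges n (Suc p))"
  define b where "b = card (block_edges n (Suc p))"
  \<comment> \<open>The largest \<open>k\<close> with \<open>(n + 1) ^ k \<le> 2 ^ (b - 2)\<close>,
    a quarter of \<open>card F\<close>.\<close>
  define k where "k = nat \<lfloor>log (Suc n) (2 ^ (b - 2))\<rfloor>"
  have "F \<subseteq> graphs_with_param_le param {..<n} p"
    using assms n max_degree_block_edges degeneracy_block_edges treewidth_block_edges[of n]
    by (auto simp: F_def graphs_with_param_le_def simple_graph_block_edges)
  have b: "real n * real p / 4 \<le> real b"
    using card_block_edges p by (simp add: b_def)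
  have "16 * 1 \<le> real n * real p"
    using n p by (intro mult_mono) auto
  then have "4 \<le> b" using b by linarith
  have card_F: "card F = 4 * 2 ^ (b - 2)"
  proof -
    have "card F = 2 ^ (2 + (b - 2))"
      using \<open>4 \<le> b\<close> by (simp add: F_def card_Pow b_def del: power_add power_Suc add_2_eq_Suc)
    then show ?thesis by (simp only: power_add) simp
  qed
  have log_nonneg: "0 \<le> log (Suc n) (2 ^ (b - 2))"
    using n by (intro zero_le_log_cancel_iff[THEN iffD2]) auto
  have "real (Suc n) ^ k = Suc n powr k"
    by (simp add: powr_realpow)
  also have "\<dots> \<le> Suc n powr log (Suc n) (2 ^ (b - 2))"
    using log_nonneg n by (intro powr_mono) (auto simp: k_def)
  also have "\<dots> = 2 ^ (b - 2)"
    using n by simp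
  finally have "real (Suc n ^ k) \<le> real (2 ^ (b - 2))" by simp
  then have "Suc n ^ k \<le> 2 ^ (b - 2)" by (simp only: of_nat_le_iff)
  then have "4 * Suc (card {..<n}) ^ k \<le> card F"
    by (simp add: card_F)
  moreover have "finite F" "F \<noteq> {}" by (auto simp: F_def)
  ultimately obtain E where E: "E \<in> F" "ennreal (real (Suc k) / 4) \<le> expected_queries A E"
    using solves_reconstruction_expected_queries
        [OF _ _ _ \<open>F \<subseteq> graphs_with_param_le param {..<n} p\<close> solves]
    by blast
  have "ln 2 / 64 * real n * real p / ln (real n) \<le> real (Suc k) / 4"
  proof -
    have "ln (real (Suc n)) \<le> ln (real n ^ 2)"
    proof (subst ln_le_cancel_iff)
      have "Suc n \<le> n * n" using n mult_le_mono1[of 16 n n] by linarith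
      then show "real (Suc n) \<le> real n ^ 2"
        by (metis of_nat_le_iff of_nat_mult power2_eq_square)
    qed (use n in auto)
    also have "\<dots> = 2 * ln (real n)"
      using n by (simp add: ln_realpow)
    finally have ln_le: "ln (real (Suc n)) \<le> 2 * ln (real n)" .
    have "0 < ln (real (Suc n))" "0 < ln (real n)" using n by auto
    \<comment> \<open>From \<open>b \<ge> 4\<close> follows
      \<open>b - 2 \<ge> b / 2\<close>.\<close>
    have "real n * real p / 8 \<le> real (b - 2)"
      using b \<open>4 \<le> b\<close> by linarith
    then have "real n * real p / 8 * ln 2 / (2 * ln (real n)) \<le> real (b - 2) * ln 2 / ln (real (Suc n))"
      using ln_le \<open>0 < ln (real (Suc n))\<close> by (intro frac_le mult_right_mono) auto
    also have "\<dots> = log (Suc n) (2 ^ (b - 2))"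
      by (simp add: log_def ln_realpow)
    \<comment> \<open>The successor absorbs the rounding in \<open>k\<close>.\<close>
    also have "\<dots> \<le> real (Suc k)"
      using log_nonneg unfolding k_def by linarith
    finally show ?thesis
      by (simp add: field_simps)
  qed
  then have "ennreal (ln 2 / 64 * real n * real p / ln (real n)) \<le> expected_queries A E"
    using E(2) ennreal_leI order_trans by blast
  then show "\<exists>E\<in>graphs_with_param_le param {..<n} p.
      ennreal (ln 2 / 64 * real n * real p / ln (real n)) \<le> expected_queries A E"
    using E(1) \<open>F \<subseteq> _\<close> by blast
qed simp

end
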